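(* Let $U,V$ be theories in the same language. (a) If $U\Subset V$, then $\widehat U\subseteq U_{\mathfrak p}$, every element of $U_{\mathfrak p}\Cup V$ is mono-derivable from $U_{\mathfrak p}$... more precisely: $\widehat U\subseteq U_{\mathfrak p}$, $U_{\mathfrak p}\subseteq_{\mathfrak m}U_{\mathfrak p}\Cup V$, and $U_{\mathfrak p}\Cup V\subseteq_{\mathfrak m}V$. (b) If $U\Subset V$ and $V$ is mono-consistent, then $V_{\mathfrak m}$ and $V_{\mathfrak n}$ weakly biseparate $U_{\mathfrak p}$ and $U_{\mathfrak r}$. (c) $U\Subset U$ if and only if $U_{\mathfrak m}=U_{\mathfrak p}$.
   Context: $T_{\mathfrak p}$ is the set of theorems of $T$, $T_{\mathfrak r}=\{\phi\mid T\vdash\neg\phi\}$. For sets of sentences $A,B$ (same language): $A\subseteq_{\mathfrak m}B$ iff for every $a\in A$ there is $b\in B$ with $b\vdash a$; $B_{\mathfrak m}=\{\phi\mid\exists\psi\in B\ \psi\vdash\phi\}$; $B_{\mathfrak n}=\{\phi\mid\exists\psi\in B\ \psi\vdash\neg\phi\}$; $B$ is mono-consistent iff no element of $B$ is inconsistent. $\widehat U$ is the set of all non-empty finite conjunctions of elements of $U$. $A\Cup B=\{\phi\wedge\psi\mid\phi\in A,\psi\in B\}$, and $U\Subset V$ iff $U\Cup V\subseteq_{\mathfrak m}V$. Sets $\mathcal Z,\mathcal W$ weakly biseparate $\mathcal A,\mathcal B$ iff $\mathcal A\subseteq\mathcal Z$, $\mathcal B\subseteq\mathcal W$, $\mathcal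 Z\cap\mathcal B=\emptyset$ and $\mathcal W\cap\mathcal A=\emptyset$.
   Formalization: Theories are sets of axioms; V is assumed non-empty for the second claim of (a) and for (b), and U non-empty for (c), since these claims fail for an empty set of axioms (the mono-consequences of the empty set are empty, but its theorems are not). *)

theory Defs
  imports Main
begin

text \<open>
  Classical one-sorted first-order logic with equality, with de Bruijn indices for variables.
  A language is given by sets of (symbol, arity) pairs, so that each of the two kinds
  of symbols may be absent altogether.
\<close>

record ('f, 'r) language =
  funs :: "('f \<times> nat) set"
  rels :: "('r \<times> nat) set"

datatype 'f tm = Var nat | Fun 'f "'f tm list"

datatype ('f, 'r) fm =
    Bot
  | Eq "'f tm" "'f tm"
  | Rel 'r "'f tm list"
  | Conj "('f, 'r) fm" "('f, 'r) fm"
  | Disj "('f, 'r) fm" "('f, 'r) fm"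
  | Imp "('f, 'r) fm" "('f, 'r) fm"
  | Forall "('f, 'r) fm"
  | Exists "('f, 'r) fm"

abbreviation Neg :: "('f, 'r) fm \<Rightarrow> ('f, 'r) fm" where
  "Neg \<phi> \<equiv> Imp \<phi> Bot"

fun wf_tm :: "('f, 'r) language \<Rightarrow> 'f tm \<Rightarrow> bool" where
  "wf_tm L (Var n) \<longleftrightarrow> True"
| "wf_tm L (Fun f ts) \<longleftrightarrow> (f, length ts) \<in> funs L \<and> (\<forall>t\<in>set ts. wf_tm L t)"

fun wf_fm :: "('f, 'r) language \<Rightarrow> ('f, 'r) fm \<Rightarrow> bool" where
  "wf_fm L Bot \<longleftrightarrow> True"
| "wf_fm L (Eq s t) \<longleftrightarrow> wf_tm L s \<and> wf_tm L t"
| "wf_fm L (Rel r ts) \<longleftrightarrow> (r, length ts) \<in> rels L \<and> (\<forall>t\<in>set ts. wf_tm L t)"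
| "wf_fm L (Conj \<phi> \<psi>) \<longleftrightarrow> wf_fm L \<phi> \<and> wf_fm L \<psi>"
| "wf_fm L (Disj \<phi> \<psi>) \<longleftrightarrow> wf_fm L \<phi> \<and> wf_fm L \<psi>"
| "wf_fm L (Imp \<phi> \<psi>) \<longleftrightarrow> wf_fm L \<phi> \<and> wf_fm L \<psi>"
| "wf_fm L (Forall \<phi>) \<longleftrightarrow> wf_fm L \<phi>"
| "wf_fm L (Exists \<phi>) \<longleftrightarrow> wf_fm L \<phi>"

fun fv_tm :: "'f tm \<Rightarrow> nat set" where
  "fv_tm (Var n) = {n}"
| "fv_tm (Fun f ts) = (\<Union>t\<in>set ts. fv_tm t)"

fun fv :: "('f, 'r) fm \<Rightarrow> nat set" where
  "fv Bot = {}"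
| "fv (Eq s t) = fv_tm s \<union> fv_tm t"
| "fv (Rel r ts) = (\<Union>t\<in>set ts. fv_tm t)"
| "fv (Conj \<phi> \<psi>) = fv \<phi> \<union> fv \<psi>"
| "fv (Disj \<phi> \<psi>) = fv \<phi> \<union> fv \<psi>"
| "fv (Imp \<phi> \<psi>) = fv \<phi> \<union> fv \<psi>"
| "fv (Forall \<phi>) = {n. Suc n \<in> fv \<phi>}"
| "fv (Exists \<phi>) = {n. Suc n \<in> fv \<phi>}"

definition sentences :: "('f, 'r) language \<Rightarrow> ('f, 'r) fm set" where
  "sentences L = {\<phi>. wf_fm L \<phi> \<and> fv \<phi> = {}}"

fun subst_tm :: "(nat \<Rightarrow> 'f tm) \<Rightarrow> 'f tm \<Rightarrow> 'f tm" where
  "subst_tm \<sigma> (Var n) = \<sigma> n"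
| "subst_tm \<sigma> (Fun f ts) = Fun f (map (subst_tm \<sigma>) ts)"

text \<open>The substitution to be applied below a quantifier: the bound variable 0 is kept.\<close>

definition up :: "(nat \<Rightarrow> 'f tm) \<Rightarrow> nat \<Rightarrow> 'f tm" where
  "up \<sigma> n = (case n of 0 \<Rightarrow> Var 0 | Suc m \<Rightarrow> subst_tm (\<lambda>k. Var (Suc k)) (\<sigma> m))"

fun subst :: "(nat \<Rightarrow> 'f tm) \<Rightarrow> ('f, 'r) fm \<Rightarrow> ('f, 'r) fm" where
  "subst \<sigma> Bot = Bot"
| "subst \<sigma> (Eq s t) = Eq (subst_tm \<sigma> s) (subst_tm \<sigma> t)"
| "subst \<sigma> (Rel r ts) = Rel r (map (subst_tm \<sigma>) ts)"
| "subst \<sigma> (Conj \<phi> \<psi>) = Conj (subst \<sigma> \<phi>) (subst \<sigma> \<psi>)"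
| "subst \<sigma> (Disj \<phi> \<psi>) = Disj (subst \<sigma> \<phi>) (subst \<sigma> \<psi>)"
| "subst \<sigma> (Imp \<phi> \<psi>) = Imp (subst \<sigma> \<phi>) (subst \<sigma> \<psi>)"
| "subst \<sigma> (Forall \<phi>) = Forall (subst (up \<sigma>) \<phi>)"
| "subst \<sigma> (Exists \<phi>) = Exists (subst (up \<sigma>) \<phi>)"

definition lift :: "('f, 'r) fm \<Rightarrow> ('f, 'r) fm" where
  "lift = subst (\<lambda>n. Var (Suc n))"

text \<open>Instantiation of the outermost bound variable in the body of a quantifier.\<close>

definition inst :: "('f, 'r) fm \<Rightarrow> 'f tm \<Rightarrow> ('f, 'r) fm" where
  "inst \<phi> t = subst (\<lambda>n. case n of 0 \<Rightarrow> t | Suc m \<Rightarrow> Var m) \<phi>"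

text \<open>
  Classical natural deduction within the language \<open>L\<close>, from an arbitrary (possibly infinite)
  set of assumptions. Lifting the assumptions in \<open>ForallI\<close> and \<open>ExistsE\<close> plays the role of the
  eigenvariable condition: variable 0 is fresh for lifted formulas.
\<close>

inductive derives :: "('f, 'r) language \<Rightarrow> ('f, 'r) fm set \<Rightarrow> ('f, 'r) fm \<Rightarrow> bool"
  for L :: "('f, 'r) language" where
  Assm: "\<phi> \<in> \<Gamma> \<Longrightarrow> wf_fm L \<phi> \<Longrightarrow> derives L \<Gamma> \<phi>"
| RAA: "wf_fm L \<phi> \<Longrightarrow> derives L (insert (Neg \<phi>) \<Gamma>) Bot \<Longrightarrow> derives L \<Gamma> \<phi>"
| ImpI: "wf_fm L \<phi> \<Longrightarrow> derives L (insert \<phi> \<Gamma>) \<psi> \<Longrightarrow> derives L \<Gamma> (Imp \<phi> \<psi>)"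
| ImpE: "derives L \<Gamma> (Imp \<phi> \<psi>) \<Longrightarrow> derives L \<Gamma> \<phi> \<Longrightarrow> derives L \<Gamma> \<psi>"
| ConjI: "derives L \<Gamma> \<phi> \<Longrightarrow> derives L \<Gamma> \<psi> \<Longrightarrow> derives L \<Gamma> (Conj \<phi> \<psi>)"
| ConjE1: "derives L \<Gamma> (Conj \<phi> \<psi>) \<Longrightarrow> derives L \<Gamma> \<phi>"
| ConjE2: "derives L \<Gamma> (Conj \<phi> \<psi>) \<Longrightarrow> derives L \<Gamma> \<psi>"
| DisjI1: "wf_fm L \<psi> \<Longrightarrow> derives L \<Gamma> \<phi> \<Longrightarrow> derives L \<Gamma> (Disj \<phi> \<psi>)"
| DisjI2: "wf_fm L \<phi> \<Longrightarrow> derives L \<Gamma> \<psi> \<Longrightarrow> derives L \<Gamma> (Disj \<phi> \<psi>)"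
| DisjE: "derives L \<Gamma> (Disj \<phi> \<psi>) \<Longrightarrow> derives L (insert \<phi> \<Gamma>) \<chi> \<Longrightarrow>
    derives L (insert \<psi> \<Gamma>) \<chi> \<Longrightarrow> derives L \<Gamma> \<chi>"
| ForallI: "derives L (lift ` \<Gamma>) \<phi> \<Longrightarrow> derives L \<Gamma> (Forall \<phi>)"
| ForallE: "wf_tm L t \<Longrightarrow> derives L \<Gamma> (Forall \<phi>) \<Longrightarrow> derives L \<Gamma> (inst \<phi> t)"
| ExistsI: "wf_tm L t \<Longrightarrow> derives L \<Gamma> (inst \<phi> t) \<Longrightarrow> derives L \<Gamma> (Exists \<phi>)"
| ExistsE: "derives L \<Gamma> (Exists \<phi>) \<Longrightarrow> derives L (insert \<phi> (lift ` \<Gamma>)) (lift \<psi>) \<Longrightarrow> derives L \<Gamma> \<psi>"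
| EqI: "wf_tm L t \<Longrightarrow> derives L \<Gamma> (Eq t t)"
| EqE: "derives L \<Gamma> (Eq s t) \<Longrightarrow> derives L \<Gamma> (inst \<phi> s) \<Longrightarrow> derives L \<Gamma> (inst \<phi> t)"

definition provables :: "('f, 'r) language \<Rightarrow> ('f, 'r) fm set \<Rightarrow> ('f, 'r) fm set" where
  "provables L T = {\<phi> \<in> sentences L. derives L T \<phi>}"

definition refutables :: "('f, 'r) language \<Rightarrow> ('f, 'r) fm set \<Rightarrow> ('f, 'r) fm set" where
  "refutables L T = {\<phi> \<in> sentences L. derives L T (Neg \<phi>)}"

definition mono_subset ::
    "('f, 'r) language \<Rightarrow> ('f, 'r) fm set \<Rightarrow> ('f, 'r) fm set \<Rightarrow> bool" where
  "mono_subset L A B \<longleftrightarrow> (\<forall>a\<in>A. \<exists>b\<in>B. derives L {b} a)"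

definition mono_provables :: "('f, 'r) language \<Rightarrow> ('f, 'r) fm set \<Rightarrow> ('f, 'r) fm set" where
  "mono_provables L B = {\<phi> \<in> sentences L. \<exists>\<psi>\<in>B. derives L {\<psi>} \<phi>}"

definition mono_refutables :: "('f, 'r) language \<Rightarrow> ('f, 'r) fm set \<Rightarrow> ('f, 'r) fm set" where
  "mono_refutables L B = {\<phi> \<in> sentences L. \<exists>\<psi>\<in>B. derives L {\<psi>} (Neg \<phi>)}"

definition mono_consistent :: "('f, 'r) language \<Rightarrow> ('f, 'r) fm set \<Rightarrow> bool" where
  "mono_consistent L B \<longleftrightarrow> (\<forall>\<psi>\<in>B. \<not> derives L {\<psi>} Bot)"

text \<open>Non-empty finite conjunctions, with arbitrary bracketing, order and repetitions.\<close>

inductive_set fin_conjs :: "('f, 'r) fm set \<Rightarrow> ('f, 'r) fm set"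
  for U :: "('f, 'r) fm set" where
  base: "\<phi> \<in> U \<Longrightarrow> \<phi> \<in> fin_conjs U"
| conj: "\<phi> \<in> fin_conjs U \<Longrightarrow> \<psi> \<in> fin_conjs U \<Longrightarrow> Conj \<phi> \<psi> \<in> fin_conjs U"

text \<open>
  \<open>pair_conjs A B\<close> is the double-cup operation on sets of sentences, and \<open>absorbed L U V\<close> is
  the double-subset relation between \<open>U\<close> and \<open>V\<close> defined from it.
\<close>

definition pair_conjs :: "('f, 'r) fm set \<Rightarrow> ('f, 'r) fm set \<Rightarrow> ('f, 'r) fm set" where
  "pair_conjs A B = {Conj \<phi> \<psi> | \<phi> \<psi>. \<phi> \<in> A \<and> \<psi> \<in> B}"

definition absorbed ::
    "('f, 'r) language \<Rightarrow> ('f, 'r) fm set \<Rightarrow> ('f, 'r) fm set \<Rightarrow> bool" where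
  "absorbed L U V \<longleftrightarrow> mono_subset L (pair_conjs U V) V"

definition weakly_biseparate :: "'a set \<Rightarrow> 'a set \<Rightarrow> 'a set \<Rightarrow> 'a set \<Rightarrow> bool" where
  "weakly_biseparate Z W A B \<longleftrightarrow> A \<subseteq> Z \<and> B \<subseteq> W \<and> Z \<inter> B = {} \<and> W \<inter> A = {}"

end

theory Submission
  imports Defs
begin

text \<open>
  A derivation from \<open>U\<close> uses only finitely many members of \<open>U\<close>. If \<open>U\<close> is absorbed by \<open>V\<close>, then
  starting from any \<open>v \<in> V\<close> these members can be absorbed one after the other, which leads to a single
  \<open>w \<in> V\<close> that proves \<open>v\<close> together with the given theorem of \<open>U\<close>. All three parts follow from this.
\<close>

text \<open>Rules that change the context either insert a formula or take the image under
  \<open>lift\<close>. Both operations are monotone, so weakening needs no renaming of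
  eigenvariables.\<close>

lemma derives_mono:
  assumes "derives L \<Gamma> \<phi>" and "\<Gamma> \<subseteq> \<Delta>"
  shows "derives L \<Delta> \<phi>"
  using assms
proof (induction arbitrary: \<Delta> rule: derives.induct)
  case (RAA \<phi> \<Gamma>)
  then show ?case by (meson derives.RAA insert_mono)
next
  case (ImpI \<phi> \<Gamma> \<psi>)
  then show ?case by (meson derives.ImpI insert_mono)
next
  case (DisjE \<Gamma> \<phi> \<psi> \<chi>)
  then show ?case by (meson derives.DisjE insert_mono)
next
  case (ForallI \<Gamma> \<phi>)
  then show ?case by (meson derives.ForallI image_mono)
next
  case (ExistsE \<Gamma> \<phi> \<psi>)
  then show ?case by (meson derives.ExistsE image_mono insert_mono)
qed (auto intro: derives.Assm derives.ImpE derives.ConjI derives.ConjE1 derives.ConjE2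
    derives.DisjI1 derives.DisjI2 derives.ForallE derives.ExistsI derives.EqI derives.EqE)

text \<open>Serves the rules that discharge an assumption \<open>a\<close>: the finite support of a
  premise is split into \<open>a\<close> and a finite part of the outer context. The last inclusion
  is not an equation because \<open>a\<close> may be absent from \<open>F\<close>; weakening then
  adds it.\<close>

lemma finite_subset_insertE:
  assumes "finite F" and "F \<subseteq> insert a A"
  obtains G where "finite G" and "G \<subseteq> A" and "F \<subseteq> insert a G"
  using that[of "F - {a}"] assms by blast

text \<open>Each rule has finitely many premises, so their finite supports can be united and every
  premise weakened to the union.\<close>

lemma derives_finite:
  assumes "derives L \<Gamma> \<phi>"
  shows "\<exists>F. finite F \<and> F \<subseteq> \<Gamma> \<and> derives L F \<phi>"
  using assms
proof (induction rule: derives.induct)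
  case (Assm \<phi> \<Gamma>)
  then show ?case by (intro exI[of _ "{\<phi>}"]) (simp add: derives.Assm)
next
  case (RAA \<phi> \<Gamma>)
  then show ?case by (meson derives.RAA derives_mono finite_subset_insertE)
next
  case (ImpI \<phi> \<Gamma> \<psi>)
  then show ?case by (meson derives.ImpI derives_mono finite_subset_insertE)
next
  case (ImpE \<Gamma> \<phi> \<psi>)
  then obtain F G where F: "finite F" "F \<subseteq> \<Gamma>" "derives L F (Imp \<phi> \<psi>)"
    and G: "finite G" "G \<subseteq> \<Gamma>" "derives L G \<phi>" by blast
  have "derives L (F \<union> G) \<psi>"
    by (rule derives.ImpE[OF derives_mono[OF F(3)] derives_mono[OF G(3)]]) simp_all
  with F G show ?case by (intro exI[of _ "F \<union> G"]) simp
next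
  case (ConjI \<Gamma> \<phi> \<psi>)
  then obtain F G where F: "finite F" "F \<subseteq> \<Gamma>" "derives L F \<phi>"
    and G: "finite G" "G \<subseteq> \<Gamma>" "derives L G \<psi>" by blast
  have "derives L (F \<union> G) (Conj \<phi> \<psi>)"
    by (rule derives.ConjI[OF derives_mono[OF F(3)] derives_mono[OF G(3)]]) simp_all
  with F G show ?case by (intro exI[of _ "F \<union> G"]) simp
next
  case (DisjE \<Gamma> \<phi> \<psi> \<chi>)
  then obtain F where F: "finite F" "F \<subseteq> \<Gamma>" "derives L F (Disj \<phi> \<psi>)" by blast
  obtain G where G: "finite G" "G \<subseteq> \<Gamma>" "derives L (insert \<phi> G) \<chi>"
    using DisjE.IH(2) by (meson derives_mono finite_subset_insertE)
  obtain H where H: "finite H" "H \<subseteq> \<Gamma>" "derives L (insert \<psi> H) \<chi>"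
    using DisjE.IH(3) by (meson derives_mono finite_subset_insertE)
  have "derives L (F \<union> G \<union> H) \<chi>"
  proof (rule derives.DisjE)
    show "derives L (F \<union> G \<union> H) (Disj \<phi> \<psi>)" by (rule derives_mono[OF F(3)]) blast
    show "derives L (insert \<phi> (F \<union> G \<union> H)) \<chi>" by (rule derives_mono[OF G(3)]) blast
    show "derives L (insert \<psi> (F \<union> G \<union> H)) \<chi>" by (rule derives_mono[OF H(3)]) blast
  qed
  with F G H show ?case by (intro exI[of _ "F \<union> G \<union> H"]) simp
next
  case (ForallI \<Gamma> \<phi>)
  then obtain F where "finite F" "F \<subseteq> lift ` \<Gamma>" "derives L F \<phi>" by blast
  \<comment> \<open>A finite set of lifted assumptions is the image of a finite set of unlifted
    ones, to which the rule applies again.\<close>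
  then show ?case by (metis derives.ForallI finite_subset_image)
next
  case (ExistsE \<Gamma> \<phi> \<psi>)
  then obtain F where F: "finite F" "F \<subseteq> \<Gamma>" "derives L F (Exists \<phi>)" by blast
  obtain G where "finite G" "G \<subseteq> lift ` \<Gamma>" and G: "derives L (insert \<phi> G) (lift \<psi>)"
    using ExistsE.IH(2) by (meson derives_mono finite_subset_insertE)
  then obtain H where H: "finite H" "H \<subseteq> \<Gamma>" "G = lift ` H"
    by (meson finite_subset_image)
  have "derives L (F \<union> H) \<psi>"
  proof (rule derives.ExistsE)
    show "derives L (F \<union> H) (Exists \<phi>)" by (rule derives_mono[OF F(3)]) blast
    show "derives L (insert \<phi> (lift ` (F \<union> H))) (lift \<psi>)"
      by (rule derives_mono[OF G]) (use H(3) in blast)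
  qed
  with F H show ?case by (intro exI[of _ "F \<union> H"]) simp
next
  case (EqI t \<Gamma>)
  then show ?case by (intro exI[of _ "{}"]) (simp add: derives.EqI)
next
  case (EqE \<Gamma> s t \<phi>)
  then obtain F G where F: "finite F" "F \<subseteq> \<Gamma>" "derives L F (Eq s t)"
    and G: "finite G" "G \<subseteq> \<Gamma>" "derives L G (inst \<phi> s)" by blast
  have "derives L (F \<union> G) (inst \<phi> t)"
    by (rule derives.EqE[OF derives_mono[OF F(3)] derives_mono[OF G(3)]]) simp_all
  with F G show ?case by (intro exI[of _ "F \<union> G"]) simp
qed (blast intro: derives.ConjE1, blast intro: derives.ConjE2, blast intro: derives.DisjI1,
    blast intro: derives.DisjI2, blast intro: derives.ForallE, blast intro: derives.ExistsI)

text \<open>The formulas of \<open>F\<close> are discharged one at a time by \<open>ImpI\<close>,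
  whose side condition is well-formedness, and supplied again by \<open>ImpE\<close>. The conclusion
  varies in the induction because \<phi> turns into \<open>Imp \<psi> \<phi>\<close>.\<close>

lemma derives_cut_finite:
  assumes "finite F" and "derives L (F \<union> \<Gamma>) \<phi>"
    and "\<And>\<psi>. \<psi> \<in> F \<Longrightarrow> wf_fm L \<psi> \<and> derives L \<Gamma> \<psi>"
  shows "derives L \<Gamma> \<phi>"
  using assms
proof (induction F arbitrary: \<phi> rule: finite_induct)
  case (insert \<psi> F)
  have "derives L (F \<union> \<Gamma>) (Imp \<psi> \<phi>)"
    using insert.prems(1) insert.prems(2)[of \<psi>] by (simp add: derives.ImpI)
  then have "derives L \<Gamma> (Imp \<psi> \<phi>)"
    by (rule insert.IH) (simp add: insert.prems(2))
  then show ?case by (rule derives.ImpE) (simp add: insert.prems(2))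
qed simp

lemma derives_trans_single:
  assumes "derives L \<Gamma> \<psi>" and "derives L {\<psi>} \<phi>" and "wf_fm L \<psi>"
  shows "derives L \<Gamma> \<phi>"
proof (rule derives_cut_finite)
  show "derives L ({\<psi>} \<union> \<Gamma>) \<phi>" using assms(2) by (rule derives_mono) simp
qed (use assms in simp_all)

text \<open>Retaining \<open>v\<close> lets later arguments transfer to \<open>w\<close> whatever
  \<open>v\<close> derives. The induction starts with \<open>w = v\<close>, and each further
  \<open>u\<close> is absorbed through \<open>Conj u w\<close>.\<close>

lemma absorbed_finite:
  assumes "absorbed L U V" and V: "V \<subseteq> sentences L" and "v \<in> V"
    and "finite F" and "F \<subseteq> U"
  shows "\<exists>w\<in>V. derives L {w} v \<and> (\<forall>u\<in>F. derives L {w} u)"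
  using assms(4,5)
proof (induction F rule: finite_induct)
  case empty
  have "derives L {v} v" using \<open>v \<in> V\<close> V by (auto simp: sentences_def intro: derives.Assm)
  with \<open>v \<in> V\<close> show ?case by blast
next
  case (insert u F)
  then obtain w where w: "w \<in> V" "derives L {w} v" "\<forall>u\<in>F. derives L {w} u" by blast
  with insert.prems have "Conj u w \<in> pair_conjs U V" by (auto simp: pair_conjs_def)
  with \<open>absorbed L U V\<close> obtain w' where w': "w' \<in> V" "derives L {w'} (Conj u w)"
    by (auto simp: absorbed_def mono_subset_def)
  have "wf_fm L w" using w(1) V by (auto simp: sentences_def)
  \<comment> \<open>Since \<open>w'\<close> derives \<open>w\<close>, nothing gained at earlier
    stages is lost.\<close>
  then have "derives L {w'} \<chi>" if "derives L {w} \<chi>" for \<chi>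
    using derives_trans_single[OF derives.ConjE2[OF w'(2)] that] by simp
  moreover have "derives L {w'} u" using w'(2) by (rule derives.ConjE1)
  ultimately show ?case using w(2,3) w'(1) by (intro bexI[of _ w']) simp_all
qed

lemma absorbed_derives:
  assumes "absorbed L U V" and "U \<subseteq> sentences L" and "V \<subseteq> sentences L" and "v \<in> V"
    and "derives L U \<phi>"
  shows "\<exists>w\<in>V. derives L {w} v \<and> derives L {w} \<phi>"
proof -
  obtain F where F: "finite F" "F \<subseteq> U" "derives L F \<phi>"
    using derives_finite[OF assms(5)] by blast
  obtain w where w: "w \<in> V" "derives L {w} v" "\<forall>u\<in>F. derives L {w} u"
    using absorbed_finite[OF assms(1,3,4) F(1,2)] by blast
  \<comment> \<open>The context is enlarged by \<open>w\<close> only to fit the finite cut, which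
    then removes \<open>F\<close>.\<close>
  have "derives L (F \<union> {w}) \<phi>" using F(3) by (rule derives_mono) blast
  with F(1) have "derives L {w} \<phi>"
    by (rule derives_cut_finite) (use w(3) F(2) assms(2) in \<open>auto simp: sentences_def\<close>)
  with w show ?thesis by blast
qed

lemma fin_conjs_provable:
  assumes "U \<subseteq> sentences L"
  shows "fin_conjs U \<subseteq> provables L U"
proof
  fix \<phi> assume "\<phi> \<in> fin_conjs U"
  then show "\<phi> \<in> provables L U"
    using assms
    by induction (auto simp: provables_def sentences_def intro: derives.Assm derives.ConjI)
qed

text \<open>Any fixed \<open>v\<close> can serve as the second conjunct of every witness.\<close>

lemma provables_mono_subset_pair_conjs:
  assumes "V \<subseteq> sentences L" and "V \<noteq> {}"
  shows "mono_subset L (provables L U) (pair_conjs (provables L U) V)"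
  unfolding mono_subset_def
proof
  fix \<phi> assume \<phi>: "\<phi> \<in> provables L U"
  obtain v where v: "v \<in> V" using \<open>V \<noteq> {}\<close> by blast
  have "derives L {Conj \<phi> v} (Conj \<phi> v)"
    using \<phi> v assms(1) by (auto simp: provables_def sentences_def intro!: derives.Assm)
  then have "derives L {Conj \<phi> v} \<phi>" by (rule derives.ConjE1)
  with \<phi> v show "\<exists>b\<in>pair_conjs (provables L U) V. derives L {b} \<phi>"
    by (auto simp: pair_conjs_def)
qed

lemma pair_conjs_provables_mono_subset:
  assumes "absorbed L U V" and "U \<subseteq> sentences L" and "V \<subseteq> sentences L"
  shows "mono_subset L (pair_conjs (provables L U) V) V"
  unfolding mono_subset_def
proof
  fix \<chi> assume "\<chi> \<in> pair_conjs (provables L U) V"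
  then obtain \<phi> v where \<chi>: "\<chi> = Conj \<phi> v" and "derives L U \<phi>" and "v \<in> V"
    by (auto simp: pair_conjs_def provables_def)
  then obtain w where "w \<in> V" and "derives L {w} v" and "derives L {w} \<phi>"
    using absorbed_derives[OF assms] by blast
  then show "\<exists>w\<in>V. derives L {w} \<chi>" using \<chi> derives.ConjI by blast
qed

text \<open>An arbitrary \<open>v\<close> starts the absorption and is then forgotten. With
  \<open>U\<close> in place of \<open>V\<close> this is the substantial inclusion of part
  (c).\<close>

lemma provables_subset_mono_provables:
  assumes "absorbed L U V" and "U \<subseteq> sentences L" and "V \<subseteq> sentences L" and "V \<noteq> {}"
  shows "provables L U \<subseteq> mono_provables L V"
  using absorbed_derives[OF assms(1-3)] assms(4)
  unfolding mono_provables_def provables_def by blast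

lemma absorbed_weakly_biseparate:
  assumes abs: "absorbed L U V" "U \<subseteq> sentences L" "V \<subseteq> sentences L"
    and con: "mono_consistent L V" and "V \<noteq> {}"
  shows "weakly_biseparate (mono_provables L V) (mono_refutables L V)
    (provables L U) (refutables L U)"
proof -
  \<comment> \<open>The contradiction between \<psi> and \<chi> is kept abstract, so that both
    disjointness claims are instances: in one \<chi> is the negation, in the other \<psi>
    is.\<close>
  have incompatible: False
    if v: "v \<in> V" and \<psi>: "derives L {v} \<psi>" and \<chi>: "derives L U \<chi>"
      and bot: "\<And>\<Gamma>. derives L \<Gamma> \<psi> \<Longrightarrow> derives L \<Gamma> \<chi> \<Longrightarrow> derives L \<Gamma> Bot"
    for v \<psi> \<chi>
  proof -
    obtain w where w: "w \<in> V" "derives L {w} v" "derives L {w} \<chi>"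
      using absorbed_derives[OF abs v \<chi>] by blast
    \<comment> \<open>Here it matters that \<open>w\<close> still derives \<open>v\<close>: both
      contradictory formulas now follow from one element of \<open>V\<close>.\<close>
    have "derives L {w} \<psi>"
      using derives_trans_single[OF w(2) \<psi>] v abs(3) by (auto simp: sentences_def)
    with w con bot show False by (auto simp: mono_consistent_def)
  qed
  have "refutables L U \<subseteq> mono_refutables L V"
    using absorbed_derives[OF abs] \<open>V \<noteq> {}\<close>
    unfolding mono_refutables_def refutables_def by blast
  moreover have False if "\<phi> \<in> mono_provables L V" "\<phi> \<in> refutables L U" for \<phi>
    using that incompatible[of _ \<phi> "Neg \<phi>"] derives.ImpE[of L _ \<phi> Bot]
    unfolding mono_provables_def refutables_def by blast
  moreover have False if "\<phi> \<in> mono_refutables L V" "\<phi> \<in> provables L U" for \<phi>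
    using that incompatible[of _ "Neg \<phi>" \<phi>] derives.ImpE[of L _ \<phi> Bot]
    unfolding mono_refutables_def provables_def by blast
  ultimately show ?thesis
    using provables_subset_mono_provables[OF abs \<open>V \<noteq> {}\<close>]
    unfolding weakly_biseparate_def by blast
qed

text \<open>From right to left, the conjunction of two axioms is a theorem, so the equation yields a
  single axiom that derives it.\<close>

lemma absorbed_self_iff:
  assumes U: "U \<subseteq> sentences L" and "U \<noteq> {}"
  shows "absorbed L U U \<longleftrightarrow> mono_provables L U = provables L U"
proof
  assume "absorbed L U U"
  then have "provables L U \<subseteq> mono_provables L U"
    using provables_subset_mono_provables assms by blast
  moreover have "mono_provables L U \<subseteq> provables L U"
    by (auto simp: mono_provables_def provables_def elim: derives_mono)
  ultimately show "mono_provables L U = provables L U" by blast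
next
  assume eq: "mono_provables L U = provables L U"
  have "pair_conjs U U \<subseteq> fin_conjs U"
    by (auto simp: pair_conjs_def intro: fin_conjs.intros)
  then have "pair_conjs U U \<subseteq> mono_provables L U"
    using fin_conjs_provable[OF U] eq by blast
  then show "absorbed L U U"
    by (auto simp: absorbed_def mono_subset_def mono_provables_def)
qed

text \<open>The provisos of non-emptiness exclude a degenerate case: the empty set absorbs every
  theory but has no mono-consequences, while \<open>provables\<close> always contains
  \<open>Imp Bot Bot\<close>.\<close>

theorem theorem2p2:
  fixes L :: "('f, 'r) language" and U V :: "('f, 'r) fm set"
  assumes "U \<subseteq> sentences L" and "V \<subseteq> sentences L"
  shows
    "(absorbed L U V \<longrightarrow>
        fin_conjs U \<subseteq> provables L U \<and>
        (V \<noteq> {} \<longrightarrow> mono_subset L (provables L U) (pair_conjs (provables L U) V)) \<and>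
        mono_subset L (pair_conjs (provables L U) V) V) \<and>
     (absorbed L U V \<and> mono_consistent L V \<and> V \<noteq> {} \<longrightarrow>
        weakly_biseparate (mono_provables L V) (mono_refutables L V)
          (provables L U) (refutables L U)) \<and>
     (U \<noteq> {} \<longrightarrow>
        (absorbed L U U \<longleftrightarrow> mono_provables L U = provables L U))"
  using assms
  by (simp add: fin_conjs_provable provables_mono_subset_pair_conjs
      pair_conjs_provables_mono_subset absorbed_weakly_biseparate absorbed_self_iff)

end
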